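(* Let $\alpha>0$, $\beta>0$, $\lambda\in\mathbb{R}$. Then for all $s\in\mathbb{C}$ with $\mathrm{Re}\,s>0$, $$\mathcal{L}\left(\frac{\partial}{\partial\alpha}\left[t^{\beta-1}W_{\alpha,\beta}(\lambda t^{\alpha})\right]\right)(s)=\frac{-\lambda\ln s}{s^{\alpha+\beta}}\,e^{\lambda s^{-\alpha}},$$ $$\mathcal{L}\left(\frac{\partial}{\partial\beta}\left[t^{\beta-1}W_{\alpha,\beta}(\lambda t^{\alpha})\right]\right)(s)=\frac{-\ln s}{s^{\beta}}\,e^{\lambda s^{-\alpha}}.$$
   Context: $W_{\alpha,\beta}(z)=\sum_{k=0}^{\infty}\frac{z^k}{k!\,\Gamma(\alpha k+\beta)}$ is the Wright function. The Laplace transform acts in the variable $t>0$: $\mathcal{L}(f(t))(s)=\int_0^\infty e^{-st}f(t)\,dt$. Powers of $s$ and $\ln s$ are principal branches. *)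

theory Defs
  imports "HOL-Analysis.Analysis"
begin

text \<open>
  At a pole of the Gamma function the library has \<open>Gamma z = 0\<close>, so that the corresponding
  summand is \<open>0\<close>, in accordance with the usual convention for the reciprocal Gamma function.
\<close>

definition Wright :: "'a \<Rightarrow> 'a \<Rightarrow> 'a \<Rightarrow> 'a::Gamma"
  where "Wright \<alpha> \<beta> z = (\<Sum>k. z ^ k / (fact k * Gamma (\<alpha> * of_nat k + \<beta>)))"

text \<open>
  The Lebesgue integral is \<open>0\<close> for a non-integrable integrand, hence the separate
  notion of (absolute) convergence.
\<close>

definition laplace_convergent :: "(real \<Rightarrow> complex) \<Rightarrow> complex \<Rightarrow> bool"
  where "laplace_convergent f s \<longleftrightarrow>
    set_integrable lborel {0<..} (\<lambda>t. exp (- s * of_real t) * f t)"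

definition laplace :: "(real \<Rightarrow> complex) \<Rightarrow> complex \<Rightarrow> complex"
  where "laplace f s = (LINT t:{0<..}|lborel. exp (- s * of_real t) * f t)"

end

theory Submission
  imports Defs "HOL-Complex_Analysis.Complex_Analysis"
begin

text \<open>
  By its series, \<open>t powr (\<beta> - 1) * Wright \<alpha> \<beta> (l * t powr \<alpha>)\<close> is the sum over \<open>k\<close> of
  \<open>l ^ k / k!\<close> times the Riemann--Liouville kernel \<open>t powr (c - 1) / Gamma c\<close> of order
  \<open>c = \<alpha> * k + \<beta>\<close>. The kernel has the Laplace transform \<open>s powr (- c)\<close>, and the derivative of the
  kernel with respect to \<open>c\<close> has the transform \<open>- Ln s * s powr (- c)\<close>
  (\<open>laplace_power_density_deriv\<close>). The parameters enter only through \<open>c\<close>, so that differentiating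
  with respect to \<open>\<beta>\<close> or \<open>\<alpha>\<close> multiplies the \<open>k\<close>-th term by \<open>1\<close> or \<open>k\<close>. The transforms of the two
  partial derivatives are therefore \<open>- Ln s * s powr (- \<beta>)\<close> times the sums of \<open>z ^ k / k!\<close> and
  \<open>k * z ^ k / k!\<close> with \<open>z = l * s powr (- \<alpha>)\<close>, that is, times \<open>exp z\<close> and \<open>z * exp z\<close>.

  Two interchanges need a justification: differentiation of the series
  (\<open>Wright_directional_derivative\<close>) and termwise integration
  (\<open>laplace_Wright_derivative_series\<close>). Both rest on \<open>power_density_deriv_bound\<close>, which dominates
  the derivative of a kernel by kernels of neighbouring orders. A majorant by the exponential
  function obtained from the boundedness of \<open>1 / Gamma\<close> alone would not do for the integral:
  it is of the size of \<open>exp (\<bar>l\<bar> * t powr \<alpha>)\<close>, which outgrows \<open>exp (Re s * t)\<close> when \<open>\<alpha> > 1\<close> and \<open>l \<noteq> 0\<close>.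
\<close>

section \<open>Differentiation under the integral sign\<close>

text \<open>
  The mean value inequality turns the uniform bound on the derivative into the same bound for
  all difference quotients, so that dominated convergence lets them pass to the limit inside
  the integral.
\<close>

lemma has_field_derivative_set_lebesgue_integral:
  fixes f :: "complex \<Rightarrow> real \<Rightarrow> complex"
  assumes S: "open S" "convex S" "z0 \<in> S"
    and f: "\<And>z. z \<in> S \<Longrightarrow> set_integrable M A (f z)"
    and f': "\<And>z x. z \<in> S \<Longrightarrow> x \<in> A \<Longrightarrow> ((\<lambda>z. f z x) has_field_derivative f' z x) (at z)"
    and meas: "set_borel_measurable M A (f' z0)"
    and B: "set_integrable M A B"
    and bound: "\<And>z x. z \<in> S \<Longrightarrow> x \<in> A \<Longrightarrow> norm (f' z x) \<le> B x"
  shows "set_integrable M A (f' z0)"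
    and "((\<lambda>z. LINT x:A|M. f z x) has_field_derivative (LINT x:A|M. f' z0 x)) (at z0)"
proof -
  define q where "q = (\<lambda>z x. (f z x - f z0 x) / (z - z0))"
  have lip: "norm (q z x) \<le> B x" if "z \<in> S" "x \<in> A" "z \<noteq> z0" for z x
  proof -
    have "norm (f z x - f z0 x) \<le> B x * norm (z - z0)"
      by (rule field_differentiable_bound[OF S(2), where f' = "\<lambda>z. f' z x"])
         (use that S bound f' in \<open>auto intro: has_field_derivative_at_within\<close>)
    then show ?thesis
      using that by (simp add: q_def norm_divide divide_le_eq)
  qed
  show int': "set_integrable M A (f' z0)"
    using B meas unfolding set_integrable_def set_borel_measurable_def
    by (rule Bochner_Integration.integrable_bound)
       (auto intro!: AE_I2 simp: indicator_def dest: bound[OF S(3)])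
  have qint: "set_integrable M A (q z)" if "z \<in> S" for z
    unfolding q_def using f[OF that] f[OF S(3)]
    by (intro set_integrable_divide set_integral_diff(1))
  have qval: "(LINT x:A|M. q z x) = ((LINT x:A|M. f z x) - (LINT x:A|M. f z0 x)) / (z - z0)"
    if "z \<in> S" for z
    unfolding q_def by (subst set_integral_divide_zero, subst set_integral_diff(2)) (use f that S in auto)
  \<comment> \<open>dominated convergence is about sequences, hence the passage to sequences tending to \<open>z0\<close>\<close>
  have "((\<lambda>z. ((LINT x:A|M. f z x) - (LINT x:A|M. f z0 x)) / (z - z0)) \<longlongrightarrow> (LINT x:A|M. f' z0 x))
      (at z0 within S)"
    unfolding tendsto_at_iff_sequentially
  proof (intro allI impI)
    fix X :: "nat \<Rightarrow> complex" assume X: "\<forall>i. X i \<in> S - {z0}" "X \<longlonglongrightarrow> z0"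
    have lim: "(\<lambda>i. q (X i) x) \<longlonglongrightarrow> f' z0 x" if "x \<in> A" for x
    proof -
      have "((\<lambda>z. q z x) \<longlongrightarrow> f' z0 x) (at z0)"
        using f'[OF S(3) that] by (simp add: has_field_derivative_iff q_def)
      then show ?thesis
        using X by (auto simp: tendsto_at_iff_sequentially o_def)
    qed
    have "(\<lambda>i. LINT x:A|M. q (X i) x) \<longlonglongrightarrow> (LINT x:A|M. f' z0 x)"
      unfolding set_lebesgue_integral_def
    proof (rule integral_dominated_convergence)
      show "integrable M (\<lambda>x. indicator A x *\<^sub>R B x)"
        using B by (simp add: set_integrable_def)
      show "(\<lambda>x. indicator A x *\<^sub>R f' z0 x) \<in> borel_measurable M"
        using meas by (simp add: set_borel_measurable_def)
      show "(\<lambda>x. indicator A x *\<^sub>R q (X i) x) \<in> borel_measurable M" for i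
        using qint[of "X i"] X by (auto simp: set_integrable_def)
      show "AE x in M. (\<lambda>i. indicator A x *\<^sub>R q (X i) x) \<longlonglongrightarrow> indicator A x *\<^sub>R f' z0 x"
      proof (intro AE_I2)
        show "(\<lambda>i. indicator A x *\<^sub>R q (X i) x) \<longlonglongrightarrow> indicator A x *\<^sub>R f' z0 x" for x
          using lim[of x] by (cases "x \<in> A") auto
      qed
      show "AE x in M. norm (indicator A x *\<^sub>R q (X i) x) \<le> indicator A x *\<^sub>R B x" for i
        using X by (intro AE_I2) (auto simp: indicator_def lip)
    qed
    then show "((\<lambda>z. ((LINT x:A|M. f z x) - (LINT x:A|M. f z0 x)) / (z - z0)) \<circ> X)
        \<longlonglongrightarrow> (LINT x:A|M. f' z0 x)"
      using X by (simp add: o_def qval)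
  qed
  then show "((\<lambda>z. LINT x:A|M. f z x) has_field_derivative (LINT x:A|M. f' z0 x)) (at z0)"
    unfolding has_field_derivative_iff at_within_open[OF S(3,1)] .
qed

section \<open>The Laplace transform of a power with and without a logarithm\<close>

text \<open>
  The exponent \<open>c\<close> is complex so that the integral over \<open>t\<close> is holomorphic in \<open>s\<close> and also in \<open>c\<close>:
  analyticity in \<open>s\<close> is needed to leave the real axis, and the derivative in \<open>c\<close> produces
  the logarithm.
\<close>

definition gamma_kernel :: "complex \<Rightarrow> complex \<Rightarrow> real \<Rightarrow> complex"
  where "gamma_kernel s c t = exp (- s * of_real t) * of_real t powr (c - 1)"

lemma norm_gamma_kernel:
  "t > 0 \<Longrightarrow> norm (gamma_kernel s c t) = exp (- Re s * t) * t powr (Re c - 1)"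
  by (simp add: gamma_kernel_def norm_mult norm_powr_real_powr)

lemma gamma_kernel_of_real:
  "t > 0 \<Longrightarrow> gamma_kernel s (of_real c) t = exp (- s * of_real t) * of_real (t powr (c - 1))"
  using powr_of_real[of t "c - 1"] by (simp add: gamma_kernel_def)

lemma borel_measurable_gamma_kernel [measurable]: "gamma_kernel s c \<in> borel_measurable borel"
  unfolding gamma_kernel_def by measurable

lemma gamma_kernel_integrable:
  assumes "Re s > 0" "Re c > 0"
  shows "set_integrable lborel {0<..} (gamma_kernel s c)"
proof -
  let ?f = "\<lambda>t. complex_of_real t powr (c - 1) / of_real (exp (Re s * t))"
  have "integrable (completion lborel) (\<lambda>t. indicator {0<..} t *\<^sub>R ?f t)"
    using absolutely_integrable_Gamma_integral[of c "Re s"] assms by (simp add: set_integrable_def)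
  then have "integrable lborel (\<lambda>t. indicator {0<..} t *\<^sub>R ?f t)"
    by (subst (asm) integrable_completion) measurable
  then show ?thesis unfolding set_integrable_def
    by (rule Bochner_Integration.integrable_bound)
       (auto intro!: AE_I2 simp: indicator_def gamma_kernel_def norm_mult norm_divide exp_minus field_simps)
qed

lemma gamma_weight_integrable:
  fixes \<sigma> c :: real
  assumes "\<sigma> > 0" "c > 0"
  shows "set_integrable lborel {0<..} (\<lambda>t. exp (- \<sigma> * t) * t powr (c - 1))"
proof -
  have "set_integrable lborel {0<..} (\<lambda>t. norm (gamma_kernel (of_real \<sigma>) (of_real c) t))"
    using gamma_kernel_integrable[of "of_real \<sigma>" "of_real c"] assms
    by (intro set_integrable_norm) auto
  then show ?thesis
    by (rule set_integrable_cong[THEN iffD1, rotated -1]) (auto simp: norm_gamma_kernel)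
qed

lemma integral_gamma_kernel_pos_real:
  fixes \<sigma> :: real
  assumes "\<sigma> > 0" "Re c > 0"
  shows "(LINT t:{0<..}|lborel. gamma_kernel (of_real \<sigma>) c t) = Gamma c * of_real \<sigma> powr (- c)"
proof -
  have I1: "(LINT t:{0<..}|lborel. gamma_kernel 1 c t) = Gamma c"
  proof -
    \<comment> \<open>the value of Euler's integral does not depend on whether the endpoint \<open>0\<close> is included\<close>
    let ?f = "\<lambda>t. of_real t powr (c - 1) / of_real (exp t)"
    have "negligible {t::real \<in> {0..} - {0<..}. ?f t \<noteq> 0}" "negligible {t::real \<in> {0<..} - {0..}. ?f t \<noteq> 0}"
      by (auto intro: negligible_subset[of "{0::real}"])
    then have "(?f has_integral Gamma c) {0<..}"
      using Gamma_integral_complex[OF assms(2)] by (subst (asm) has_integral_spike_set_eq[where T = "{0<..}"])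
    then have "(gamma_kernel 1 c has_integral Gamma c) {0<..}"
      by (rule has_integral_eq[rotated])
         (simp add: gamma_kernel_def exp_minus field_simps flip: exp_of_real)
    then show ?thesis
      using set_borel_integral_eq_integral(2)[OF gamma_kernel_integrable[of 1 c]] assms
      by (simp add: integral_unique)
  qed
  \<comment> \<open>the general \<open>\<sigma>\<close> reduces to \<open>1\<close> by the substitution \<open>t \<mapsto> \<sigma> t\<close>\<close>
  have "Gamma c = (LINT t|lborel. indicator {0<..} t *\<^sub>R gamma_kernel 1 c t)"
    using I1 by (simp add: set_lebesgue_integral_def)
  also have "\<dots> = \<sigma> *\<^sub>R (LINT t|lborel. indicator {0<..} (\<sigma> * t) *\<^sub>R gamma_kernel 1 c (\<sigma> * t))"
    using assms lborel_integral_real_affine[of \<sigma> "\<lambda>t. indicator {0<..} t *\<^sub>R gamma_kernel 1 c t" 0]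
    by simp
  also have "(\<lambda>t. indicator {0<..} (\<sigma> * t) *\<^sub>R gamma_kernel 1 c (\<sigma> * t)) =
      (\<lambda>t. (of_real \<sigma> powr (c - 1)) * (indicator {0<..} t *\<^sub>R gamma_kernel (of_real \<sigma>) c t))"
    using assms by (intro ext) (auto simp: indicator_def gamma_kernel_def zero_less_mult_iff powr_times_real)
  finally have "Gamma c = of_real \<sigma> * of_real \<sigma> powr (c - 1) *
      (LINT t:{0<..}|lborel. gamma_kernel (of_real \<sigma>) c t)"
    by (simp add: set_lebesgue_integral_def scaleR_conv_of_real)
  also have "of_real \<sigma> * of_real \<sigma> powr (c - 1) = complex_of_real \<sigma> powr c"
    using assms by (simp add: powr_diff)
  finally show ?thesis
    using assms by (simp add: powr_minus field_simps)
qed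

text \<open>
  For complex \<open>s\<close> the substitution \<open>t \<mapsto> s t\<close> would leave the real line. Instead, both sides
  are holomorphic in the half-plane and agree on the positive real axis, hence everywhere.
\<close>

lemma integral_gamma_kernel:
  assumes "Re s > 0" "Re c > 0"
  shows "(LINT t:{0<..}|lborel. gamma_kernel s c t) = Gamma c * s powr (- c)"
proof -
  let ?H = "{z. Re z > 0}"
  define F where "F = (\<lambda>s. LINT t:{0<..}|lborel. gamma_kernel s c t)"
  have der: "\<exists>D. (F has_field_derivative D) (at s)" if s: "Re s > 0" for s
    unfolding F_def
  proof (intro exI, rule has_field_derivative_set_lebesgue_integral(2))
    \<comment> \<open>on the half-plane \<open>Re z > Re s / 2\<close> the derivative has an integrable majorant\<close>
    show "open {z. Re z > Re s / 2}" "convex {z. Re z > Re s / 2}"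
      by (rule open_halfspace_Re_gt convex_halfspace_Re_gt)+
    show "s \<in> {z. Re z > Re s / 2}" using s by simp
    show "set_integrable lborel {0<..} (\<lambda>t. exp (- (Re s / 2) * t) * t powr ((Re c + 1) - 1))"
      using s assms by (intro gamma_weight_integrable) auto
    show "set_integrable lborel {0<..} (gamma_kernel z c)" if "z \<in> {z. Re z > Re s / 2}" for z
      using that s assms by (intro gamma_kernel_integrable) auto
    show "((\<lambda>z. gamma_kernel z c t) has_field_derivative (- of_real t * gamma_kernel z c t)) (at z)"
      for z t unfolding gamma_kernel_def by (auto intro!: derivative_eq_intros)
    show "set_borel_measurable lborel {0<..} (\<lambda>t. - of_real t * gamma_kernel s c t)"
      unfolding set_borel_measurable_def by measurable
    show "norm (- of_real t * gamma_kernel z c t) \<le> exp (- (Re s / 2) * t) * t powr ((Re c + 1) - 1)"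
      if z: "z \<in> {z. Re z > Re s / 2}" and t: "t \<in> {0<..}" for z t
    proof -
      have "norm (- of_real t * gamma_kernel z c t) = exp (- Re z * t) * (t * t powr (Re c - 1))"
        using t by (simp add: norm_mult norm_gamma_kernel)
      also have "t * t powr (Re c - 1) = t powr ((Re c + 1) - 1)"
        using t by (simp add: powr_diff)
      also have "exp (- Re z * t) \<le> exp (- (Re s / 2) * t)"
        using z t by (simp add: field_simps) 
      finally show ?thesis by (simp add: mult_right_mono)
    qed
  qed
  have "F s - Gamma c * s powr (- c) = 0"
  proof (rule analytic_continuation[of "\<lambda>s. F s - Gamma c * s powr (- c)" ?H "of_real ` {0<..}" 1])
    show "(\<lambda>s. F s - Gamma c * s powr (- c)) holomorphic_on ?H"
    proof (intro holomorphic_intros)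
      show "F holomorphic_on ?H"
        using der open_halfspace_Re_gt[of 0]
        by (auto simp: holomorphic_on_open)
      show "s \<notin> \<real>\<^sub>\<le>\<^sub>0" if "s \<in> ?H" for s
        using that by (auto simp: complex_nonpos_Reals_iff)
    qed
    show "open ?H" "connected ?H"
      by (auto intro: open_halfspace_Re_gt convex_halfspace_Re_gt convex_connected)
    have "(1::real) islimpt {0<..}"
      by (intro interior_limit_point) (simp add: interior_open)
    then have "complex_of_real 1 islimpt complex_of_real ` {0<..}"
      by (rule islimpt_isCont_image) (auto simp: eventually_at_filter)
    then show "1 islimpt complex_of_real ` {0<..}" by simp
  qed (use assms in \<open>auto simp: F_def integral_gamma_kernel_pos_real\<close>)
  then show ?thesis by (simp add: F_def)
qed

lemma abs_ln_le:
  fixes t :: real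
  assumes "t > 0" "\<delta> > 0"
  shows "\<bar>ln t\<bar> \<le> t + t powr (- \<delta>) / \<delta>"
proof -
  have "ln t \<le> t" using assms ln_less_self[of t] by linarith
  moreover have "- ln t \<le> t powr (- \<delta>) / \<delta>"
    using ln_less_self[of "t powr (- \<delta>)"] assms by (simp add: ln_powr field_simps)
  moreover have "0 \<le> t powr (- \<delta>) / \<delta>" using assms by simp
  ultimately show ?thesis using assms by linarith
qed

text \<open>
  Differentiating the Euler integral with respect to its exponent brings down a factor \<open>ln t\<close>
  on one side and, by the product rule, \<open>Digamma c - Ln s\<close> on the other.
\<close>

lemma gamma_kernel_ln:
  assumes "Re s > 0" "Re c > 0"
  shows "set_integrable lborel {0<..} (\<lambda>t. of_real (ln t) * gamma_kernel s c t)"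
    and "(LINT t:{0<..}|lborel. of_real (ln t) * gamma_kernel s c t) =
      Gamma c * s powr (- c) * (Digamma c - Ln s)"
proof -
  define a b where "a = Re c / 2" and "b = 2 * Re c"
  have ab: "0 < a" "a < Re c" "Re c < b" using assms by (auto simp: a_def b_def)
  let ?S = "{z. Re z > a} \<inter> {z. Re z < b}"
  let ?w = "\<lambda>p t. exp (- Re s * t) * t powr (p - 1)"
  \<comment> \<open>in the strip \<open>a < Re z < b\<close> the power is at most the sum of the two boundary powers, and the
    logarithm costs a factor \<open>t\<close> near infinity and \<open>t powr (- (a / 2))\<close> near \<open>0\<close>\<close>
  let ?B = "\<lambda>t. (?w (a + 1) t + ?w (b + 1) t) + (?w (a / 2) t + ?w (b - a / 2) t) / (a / 2)"
  let ?f' = "\<lambda>c t. of_real (ln t) * gamma_kernel s c t"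
  have S: "open ?S" "convex ?S"
      by (auto intro: open_halfspace_Re_gt open_halfspace_Re_lt convex_halfspace_Re_gt
        convex_halfspace_Re_lt convex_Int)
  have c: "c \<in> ?S" using ab by simp
  have B: "set_integrable lborel {0<..} ?B"
    using ab assms by (intro set_integral_add set_integrable_divide gamma_weight_integrable) auto
  have int: "set_integrable lborel {0<..} (gamma_kernel s z)" if "z \<in> ?S" for z
    using that assms ab by (intro gamma_kernel_integrable) auto
  have der: "((\<lambda>z. gamma_kernel s z t) has_field_derivative ?f' z t) (at z)"
    if "t \<in> {0<..}" for z t
  proof -
    have "((\<lambda>z. of_real t powr (z - 1)) has_field_derivative Ln (of_real t) * of_real t powr (z - 1) * 1) (at z)"
      using that
      by (intro has_field_derivative_powr_right[THEN DERIV_chain2]) (auto intro!: derivative_eq_intros)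
    then show ?thesis
      unfolding gamma_kernel_def using that
      by (auto intro!: derivative_eq_intros simp: Ln_of_real)
  qed
  have meas: "set_borel_measurable lborel {0<..} (?f' c)"
    unfolding set_borel_measurable_def by measurable
  have bound: "norm (?f' z t) \<le> ?B t"
    if z: "z \<in> ?S" and t: "t \<in> {0<..}" for z t
  proof -
    have "t powr (Re z - 1) \<le> t powr (a - 1) + t powr (b - 1)"
    proof (cases "t \<le> 1")
      case True
      then have "t powr (Re z - 1) \<le> t powr (a - 1)"
        using z t by (intro powr_mono') auto
      then show ?thesis by (simp add: add_increasing2)
    next
      case False
      then have "t powr (Re z - 1) \<le> t powr (b - 1)"
        using z t by (intro powr_mono) auto
      then show ?thesis by (simp add: add_increasing)
    qed
    moreover have "\<bar>ln t\<bar> \<le> t + t powr (- (a / 2)) / (a / 2)"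
      using t ab by (intro abs_ln_le) auto
    ultimately have "\<bar>ln t\<bar> * t powr (Re z - 1) \<le>
        (t + t powr (- (a / 2)) / (a / 2)) * (t powr (a - 1) + t powr (b - 1))"
      using t ab by (intro mult_mono) auto
    then have "exp (- Re s * t) * (\<bar>ln t\<bar> * t powr (Re z - 1)) \<le> exp (- Re s * t) *
        ((t + t powr (- (a / 2)) / (a / 2)) * (t powr (a - 1) + t powr (b - 1)))"
      by (intro mult_left_mono) auto
    also have "\<dots> = ?B t"
    proof -
      have "t * t powr (p - 1) = t powr (p + 1 - 1)" for p
        using t by (simp add: powr_diff)
      moreover have "t powr (- (a / 2)) * t powr (p - 1) = t powr (p - a / 2 - 1)" for p
        by (simp add: algebra_simps flip: powr_add)
      ultimately show ?thesis
        by (simp add: algebra_simps)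
    qed
    finally show ?thesis
      using t by (simp add: norm_mult norm_gamma_kernel mult_ac)
  qed
  note D = has_field_derivative_set_lebesgue_integral[OF S c int der meas B bound]
  show "set_integrable lborel {0<..} (\<lambda>t. of_real (ln t) * gamma_kernel s c t)" by (rule D(1))
  have s0: "s \<noteq> 0" using assms by auto
  have "c \<notin> \<int>\<^sub>\<le>\<^sub>0" using assms by (auto elim!: nonpos_Ints_cases)
  moreover have "((\<lambda>c. s powr (- c)) has_field_derivative Ln s * s powr (- c) * - 1) (at c)"
    using s0
    by (intro has_field_derivative_powr_right[THEN DERIV_chain2]) (auto intro!: derivative_eq_intros)
  ultimately have "((\<lambda>c. Gamma c * s powr (- c)) has_field_derivative
      Gamma c * s powr (- c) * (Digamma c - Ln s)) (at c)"
    by (auto intro!: derivative_eq_intros simp: algebra_simps)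
  then have "((\<lambda>c. LINT t:{0<..}|lborel. gamma_kernel s c t) has_field_derivative
      Gamma c * s powr (- c) * (Digamma c - Ln s)) (at c)"
    by (rule has_field_derivative_transform_within_open[of _ _ _ "{z. Re z > 0}"])
       (use assms in \<open>auto intro: open_halfspace_Re_gt simp: integral_gamma_kernel\<close>)
  with D(2) show "(LINT t:{0<..}|lborel. of_real (ln t) * gamma_kernel s c t) =
      Gamma c * s powr (- c) * (Digamma c - Ln s)"
    by (rule DERIV_unique)
qed

section \<open>The derivative of the Riemann--Liouville kernel in its order\<close>

text \<open>
  The Riemann--Liouville kernel of order \<open>c\<close>, whose Laplace transform is the pure power
  \<open>s powr (- c)\<close>.
\<close>

definition power_density :: "real \<Rightarrow> real \<Rightarrow> real"
  where "power_density c t = rGamma c * t powr (c - 1)"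

definition power_density_deriv :: "real \<Rightarrow> real \<Rightarrow> real"
  where "power_density_deriv c t = power_density c t * (ln t - Digamma c)"

lemma power_density_pos: "c > 0 \<Longrightarrow> t > 0 \<Longrightarrow> power_density c t > 0"
  using Gamma_real_pos[of c] by (simp add: power_density_def rGamma_inverse_Gamma del: Gamma_real_pos)

lemma has_field_derivative_power_density:
  assumes "c > 0" "t > 0"
  shows "((\<lambda>c. power_density c t) has_field_derivative power_density_deriv c t) (at c)"
proof -
  have "c \<notin> \<int>\<^sub>\<le>\<^sub>0" using assms by (auto elim!: nonpos_Ints_cases)
  moreover have "((\<lambda>c. t powr (c - 1)) has_field_derivative t powr (c - 1) * ln t) (at c)"
    using assms by (auto intro!: derivative_eq_intros)
  ultimately show ?thesis
    unfolding power_density_def power_density_deriv_def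
    by (auto intro!: derivative_eq_intros simp: algebra_simps)
qed

lemma laplace_integrable_power_density:
  assumes "\<sigma> > 0" "c > 0"
  shows "set_integrable lborel {0<..} (\<lambda>t. exp (- \<sigma> * t) * power_density c t)"
proof -
  have "(\<lambda>t. exp (- \<sigma> * t) * power_density c t) = (\<lambda>t. rGamma c * (exp (- \<sigma> * t) * t powr (c - 1)))"
    by (simp add: power_density_def mult_ac)
  then show ?thesis
    using gamma_weight_integrable[OF assms] by simp
qed

lemma laplace_power_density:
  assumes "\<sigma> > 0" "c > 0"
  shows "(LINT t:{0<..}|lborel. exp (- \<sigma> * t) * power_density c t) = \<sigma> powr (- c)"
proof -
  have "complex_of_real (LINT t:{0<..}|lborel. exp (- \<sigma> * t) * t powr (c - 1)) =
      (LINT t:{0<..}|lborel. gamma_kernel (of_real \<sigma>) (of_real c) t)"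
    unfolding set_integral_complex_of_real[symmetric]
    by (intro set_lebesgue_integral_cong) (auto simp: gamma_kernel_of_real simp flip: exp_of_real)
  also have "\<dots> = complex_of_real (Gamma c * \<sigma> powr (- c))"
    using assms powr_of_real[of \<sigma> "- c"]
    by (subst integral_gamma_kernel) (auto simp: Gamma_complex_of_real)
  finally have "(LINT t:{0<..}|lborel. exp (- \<sigma> * t) * t powr (c - 1)) = Gamma c * \<sigma> powr (- c)"
    by (simp only: of_real_eq_iff)
  moreover have "(\<lambda>t. exp (- \<sigma> * t) * power_density c t) = (\<lambda>t. rGamma c * (exp (- \<sigma> * t) * t powr (c - 1)))"
    by (simp add: power_density_def mult_ac)
  moreover have "Gamma c \<noteq> 0" using assms by (metis Gamma_real_pos less_irrefl)
  ultimately show ?thesis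
    by (simp add: rGamma_inverse_Gamma)
qed

text \<open>
  The two digamma terms, one from differentiating \<open>1 / Gamma c\<close> and one from
  the transform of \<open>ln t\<close> times a power, cancel. What is left is the derivative of \<open>s powr (- c)\<close>.
\<close>

lemma laplace_power_density_deriv:
  assumes "Re s > 0" "c > 0"
  shows "set_integrable lborel {0<..} (\<lambda>t. exp (- s * of_real t) * of_real (power_density_deriv c t))"
    and "(LINT t:{0<..}|lborel. exp (- s * of_real t) * of_real (power_density_deriv c t)) =
      - Ln s * s powr (- of_real c)"
proof -
  let ?h = "\<lambda>t. of_real (rGamma c) * (of_real (ln t) * gamma_kernel s (of_real c) t -
      of_real (Digamma c) * gamma_kernel s (of_real c) t)"
  have eq: "exp (- s * of_real t) * of_real (power_density_deriv c t) = ?h t" if "t \<in> {0<..}" for t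
    using that
    by (simp add: gamma_kernel_of_real power_density_def power_density_deriv_def algebra_simps)
  note int = gamma_kernel_integrable[of s "of_real c"] gamma_kernel_ln(1)[of s "of_real c"]
  have int_h: "set_integrable lborel {0<..} ?h"
    using int assms by (intro set_integrable_mult_right set_integral_diff) auto
  then show "set_integrable lborel {0<..} (\<lambda>t. exp (- s * of_real t) * of_real (power_density_deriv c t))"
    using eq by (subst set_integrable_cong[of lborel lborel "{0<..}" _ _ ?h]) auto
  have "(LINT t:{0<..}|lborel. exp (- s * of_real t) * of_real (power_density_deriv c t)) =
      (LINT t:{0<..}|lborel. ?h t)"
    using eq by (intro set_lebesgue_integral_cong) auto
  also have "\<dots> = of_real (rGamma c) * (Gamma (of_real c) * s powr (- of_real c) *
        (Digamma (of_real c) - Ln s) - of_real (Digamma c) * (Gamma (of_real c) * s powr (- of_real c)))"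
    using int assms
    by (subst set_integral_mult_right, subst set_integral_diff)
       (auto simp: gamma_kernel_ln(2) integral_gamma_kernel)
  also have "\<dots> = (of_real (rGamma c) * Gamma (of_real c)) * (- Ln s * s powr (- of_real c))"
    using assms by (simp add: Polygamma_of_real algebra_simps)
  also have "of_real (rGamma c) * Gamma (complex_of_real c) = 1"
    using assms Gamma_real_pos[of c] by (simp add: Gamma_complex_of_real rGamma_inverse_Gamma del: Gamma_real_pos)
  finally show "(LINT t:{0<..}|lborel. exp (- s * of_real t) * of_real (power_density_deriv c t)) =
      - Ln s * s powr (- of_real c)" by simp
qed

section \<open>Estimates from the convexity of the logarithm of the Gamma function\<close>

text \<open>
  All estimates of Gamma and digamma below are read off from the convexity of \<open>ln_Gamma\<close>.
\<close>

lemma ln_Gamma_real_above_tangent: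
  assumes "x > 0" "y > (0::real)"
  shows "ln_Gamma y \<ge> ln_Gamma x + Digamma x * (y - x)"
proof -
  have "convex_on {0<..} (ln_Gamma :: real \<Rightarrow> real)"
    by (rule convex_on_realI[of _ _ Digamma])
       (auto intro!: derivative_eq_intros Digamma_real_mono)
  moreover have "(ln_Gamma has_field_derivative Digamma x) (at x within {0<..})"
    by (rule has_field_derivative_at_within[OF has_field_derivative_ln_Gamma_real[OF assms(1)]])
  ultimately have "ln_Gamma y - ln_Gamma x \<ge> Digamma x * (y - x)"
    using assms
    by (intro convex_on_imp_above_tangent[where A = "{0<..}" and f = ln_Gamma]) (auto simp: interior_open)
  then show ?thesis by simp
qed

lemma rGamma_real_exp_ln_Gamma: "x > (0::real) \<Longrightarrow> rGamma x = exp (- ln_Gamma x)"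
  by (simp add: rGamma_inverse_Gamma Gamma_real_pos_exp exp_minus)

text \<open>
  The tangent of \<open>ln_Gamma\<close> at \<open>3/2\<close> has positive slope, so it bounds \<open>ln_Gamma\<close> from below on
  the whole positive axis by its value at \<open>0\<close>.
\<close>

lemma rGamma_real_bounded:
  obtains M :: real where "M > 0" "\<And>x. x > 0 \<Longrightarrow> rGamma x \<le> M"
proof
  define M :: real where "M = exp (Digamma (3/2) * (3/2) - ln_Gamma (3/2))"
  show "M > 0" by (simp add: M_def)
  show "rGamma x \<le> M" if "x > 0" for x
  proof -
    have "0 \<le> Digamma (3/2) * x"
      using Digamma_real_three_halves_pos that by simp
    then have "- ln_Gamma x \<le> Digamma (3/2) * (3/2) - ln_Gamma (3/2)"
      using ln_Gamma_real_above_tangent[of "3/2" x] that by (simp add: algebra_simps)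
    then show ?thesis using that by (simp add: rGamma_real_exp_ln_Gamma M_def)
  qed
qed

text \<open>
  The slope of the tangent at \<open>x\<close> is at most that of the chord from \<open>x\<close> to \<open>x + 1\<close>, which is \<open>ln x\<close>.
\<close>

lemma Digamma_real_le_self:
  assumes "x > (0::real)"
  shows "Digamma x \<le> x"
proof -
  have "Digamma x \<le> ln_Gamma (x + 1) - ln_Gamma x"
    using ln_Gamma_real_above_tangent[of x "x + 1"] assms by simp
  also have "\<dots> = ln x"
  proof -
    have "x \<notin> \<int>\<^sub>\<le>\<^sub>0" using assms by (auto elim!: nonpos_Ints_cases)
    then have "Gamma (x + 1) = x * Gamma x" by (rule Gamma_plus1)
    moreover have "Gamma x > 0" using assms by (rule Gamma_real_pos)
    ultimately show ?thesis using assms by (simp add: ln_Gamma_real_pos ln_mult less_imp_neq[symmetric])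
  qed
  also have "\<dots> \<le> x" using assms ln_less_self[of x] by linarith
  finally show ?thesis .
qed

lemma abs_Digamma_real_le:
  assumes "0 < x0" "x0 \<le> (x::real)"
  shows "\<bar>Digamma x\<bar> \<le> \<bar>Digamma x0\<bar> + x"
  using Digamma_real_mono[OF assms] Digamma_real_le_self[of x] assms by linarith

text \<open>
  Over an interval of length \<open>\<delta>\<close>, \<open>ln_Gamma\<close> increases by at least \<open>\<delta>\<close> times its slope at the left
  end, which is smallest when the left end is \<open>x0 - \<delta>\<close>.
\<close>

lemma rGamma_real_shift_le:
  assumes "0 < \<delta>" "\<delta> < x0" "x0 \<le> (x::real)"
  shows "rGamma x \<le> exp (- \<delta> * Digamma (x0 - \<delta>)) * rGamma (x - \<delta>)"
proof -
  have "\<delta> * Digamma (x0 - \<delta>) \<le> \<delta> * Digamma (x - \<delta>)"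
    using assms by (intro mult_left_mono Digamma_real_mono) auto
  also have "\<dots> \<le> ln_Gamma x - ln_Gamma (x - \<delta>)"
    using ln_Gamma_real_above_tangent[of "x - \<delta>" x] assms by (simp add: mult.commute)
  finally show ?thesis
    using assms by (simp add: rGamma_real_exp_ln_Gamma flip: exp_add)
qed

text \<open>
  The derivative differs from the kernel by the factor \<open>ln t - Digamma c\<close>. A factor \<open>t\<close>
  raises the order of the kernel by one at the cost of a factor \<open>c\<close>, and a factor
  \<open>t powr (- (c0 / 2))\<close> lowers it by \<open>c0 / 2\<close> at a cost that is bounded uniformly in \<open>c \<ge> c0\<close>.
  Thus the logarithm is absorbed by kernels of neighbouring orders. Keeping the Gamma function
  inside these kernels is essential: the exact value of their Laplace transforms then gives
  an \<open>L1\<close> bound that grows at most exponentially in \<open>c\<close>.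
\<close>

lemma power_density_deriv_bound:
  assumes "c0 > 0"
  obtains C where "C > 0" "\<And>c t. c0 \<le> c \<Longrightarrow> 0 < t \<Longrightarrow> \<bar>power_density_deriv c t\<bar> \<le>
    C * (1 + c) * (power_density (c + 1) t + power_density (c - c0 / 2) t + power_density c t)"
proof -
  define \<delta> where "\<delta> = c0 / 2"
  have \<delta>: "0 < \<delta>" "\<delta> < c0" using assms by (auto simp: \<delta>_def)
  define K where "K = exp (- \<delta> * Digamma (c0 - \<delta>)) / \<delta>"
  define A where "A = \<bar>Digamma c0\<bar>"
  define C where "C = 1 + K + A"
  have pos: "K > 0" "A \<ge> 0" using \<delta> by (auto simp: K_def A_def)
  have "\<bar>power_density_deriv c t\<bar> \<le>
      C * (1 + c) * (power_density (c + 1) t + power_density (c - \<delta>) t + power_density c t)"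
    if c: "c0 \<le> c" and t: "0 < t" for c t
  proof -
    have c': "0 < c" using assms c by simp
    let ?g = "power_density c t" and ?g1 = "power_density (c + 1) t"
      and ?g2 = "power_density (c - \<delta>) t"
    have g: "?g > 0" "?g1 > 0" "?g2 > 0"
      using c' t c \<delta> by (auto intro!: power_density_pos)
    have 1: "t * ?g = c * ?g1"
      using t c' rGamma_plus1[of c] by (simp add: power_density_def powr_diff field_simps)
    have 2: "t powr (- \<delta>) / \<delta> * ?g \<le> K * ?g2"
    proof -
      have "t powr (- \<delta>) / \<delta> * ?g = rGamma c * (t powr (c - \<delta> - 1) / \<delta>)"
        by (simp add: power_density_def algebra_simps flip: powr_add)
      also have "\<dots> \<le> (exp (- \<delta> * Digamma (c0 - \<delta>)) * rGamma (c - \<delta>)) * (t powr (c - \<delta> - 1) / \<delta>)"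
        using \<delta> c by (intro mult_right_mono rGamma_real_shift_le) auto
      finally show ?thesis by (simp add: K_def power_density_def)
    qed
    have "\<bar>power_density_deriv c t\<bar> = ?g * \<bar>ln t - Digamma c\<bar>"
      using g by (simp add: power_density_deriv_def abs_mult)
    also have "\<dots> \<le> ?g * (t + t powr (- \<delta>) / \<delta> + (A + c))"
      using abs_ln_le[OF t \<delta>(1)] abs_Digamma_real_le[OF assms c] g
      by (intro mult_left_mono) (auto simp: A_def)
    also have "\<dots> = t * ?g + t powr (- \<delta>) / \<delta> * ?g + (A + c) * ?g"
      by (simp add: algebra_simps)
    also have "\<dots> \<le> c * ?g1 + K * ?g2 + (A + c) * ?g"
      using 1 2 by simp
    also have "\<dots> \<le> C * (1 + c) * ?g1 + C * (1 + c) * ?g2 + C * (1 + c) * ?g"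
    proof (intro add_mono mult_right_mono)
      have nn: "0 \<le> K * c" "0 \<le> A * c" using pos c' by auto
      show "c \<le> C * (1 + c)" "K \<le> C * (1 + c)" "A + c \<le> C * (1 + c)"
        using pos c' nn by (auto simp: C_def algebra_simps)
    qed (use g in auto)
    finally show ?thesis by (simp add: algebra_simps)
  qed
  moreover have "C > 0" using pos by (simp add: C_def)
  ultimately show ?thesis using that unfolding \<delta>_def by blast
qed

lemma powr_le_powr_of_inverse_le:
  fixes t T x y :: real
  assumes "0 < t" "t \<le> T" "inverse t \<le> T" "1 \<le> T" "\<bar>x\<bar> \<le> y"
  shows "t powr x \<le> T powr y"
proof -
  have "t powr x \<le> T powr \<bar>x\<bar>"
  proof (cases "x \<ge> 0")
    case True
    then show ?thesis using assms by (simp add: powr_mono2)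
  next
    case False
    then have "t powr x = inverse t powr \<bar>x\<bar>"
      using assms by (simp add: powr_minus inverse_powr)
    also have "\<dots> \<le> T powr \<bar>x\<bar>" using assms by (intro powr_mono2) auto
    finally show ?thesis .
  qed
  also have "\<dots> \<le> T powr y" using assms by (intro powr_mono) auto
  finally show ?thesis .
qed

text \<open>
  For fixed \<open>t\<close> and in the \<open>L1\<close> norm alike, the growth in \<open>c\<close> is at most \<open>(1 + c) * T powr (c + 2)\<close>
  for some \<open>T\<close>. The common form allows a single majorant series for
  termwise differentiation and for termwise integration.
\<close>

lemma power_density_deriv_pointwise_bound:
  assumes "c0 > 0" "t > 0"
  obtains C T where "C > 0" "T \<ge> 1"
    "\<And>c. c0 \<le> c \<Longrightarrow> power_density c t \<le> C * (1 + c) * T powr (c + 2)"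
    "\<And>c. c0 \<le> c \<Longrightarrow> \<bar>power_density_deriv c t\<bar> \<le> C * (1 + c) * T powr (c + 2)"
proof -
  obtain M :: real where M: "M > 0" "\<And>x. x > 0 \<Longrightarrow> rGamma x \<le> M"
    using rGamma_real_bounded by blast
  obtain C where C: "C > 0" "\<And>c t. c0 \<le> c \<Longrightarrow> 0 < t \<Longrightarrow> \<bar>power_density_deriv c t\<bar> \<le>
      C * (1 + c) * (power_density (c + 1) t + power_density (c - c0 / 2) t + power_density c t)"
    using power_density_deriv_bound[OF assms(1)] by blast
  \<comment> \<open>a single base that dominates both positive and negative powers of \<open>t\<close>\<close>
  define T where "T = max 1 (max t (inverse t))"
  have T: "T \<ge> 1" "t \<le> T" "inverse t \<le> T" by (auto simp: T_def)
  have pd: "power_density x t \<le> M * T powr (c + 2)" if "0 < x" "x \<le> c + 1" for x c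
    unfolding power_density_def using M that T assms
    by (intro mult_mono powr_le_powr_of_inverse_le) auto
  show thesis
  proof (rule that[of "M + 3 * C * M" T])
    show "M + 3 * C * M > 0" "T \<ge> 1"
      using M C T by (auto intro: add_pos_pos)
    fix c assume c: "c0 \<le> c"
    let ?P = "T powr (c + 2)"
    have nn: "0 \<le> C * M * (1 + c) * ?P" "0 \<le> M * c * ?P" "0 \<le> M * ?P" 
      using M C c assms by auto
    have "power_density c t \<le> M * ?P" using c assms by (intro pd) auto
    also have "\<dots> \<le> (M + 3 * C * M) * (1 + c) * ?P"
      using nn by (simp add: algebra_simps)
    finally show "power_density c t \<le> (M + 3 * C * M) * (1 + c) * ?P" .
    have "\<bar>power_density_deriv c t\<bar> \<le>
        C * (1 + c) * (power_density (c + 1) t + power_density (c - c0 / 2) t + power_density c t)"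
      using c assms by (intro C) auto
    also have "\<dots> \<le> C * (1 + c) * (M * ?P + M * ?P + M * ?P)"
      using c assms C by (intro mult_left_mono add_mono pd) auto
    also have "\<dots> \<le> (M + 3 * C * M) * (1 + c) * ?P"
      using nn by (simp add: algebra_simps)
    finally show "\<bar>power_density_deriv c t\<bar> \<le> (M + 3 * C * M) * (1 + c) * ?P" .
  qed
qed

lemma power_density_deriv_L1_bound:
  assumes "c0 > 0" "\<sigma> > 0"
  obtains C T where "C > 0" "T \<ge> 1"
    "\<And>c. c0 \<le> c \<Longrightarrow> (LINT t:{0<..}|lborel. exp (- \<sigma> * t) * \<bar>power_density_deriv c t\<bar>)
        \<le> C * (1 + c) * T powr (c + 2)"
proof -
  obtain C where C: "C > 0" "\<And>c t. c0 \<le> c \<Longrightarrow> 0 < t \<Longrightarrow> \<bar>power_density_deriv c t\<bar> \<le>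
      C * (1 + c) * (power_density (c + 1) t + power_density (c - c0 / 2) t + power_density c t)"
    using power_density_deriv_bound[OF assms(1)] by blast
  define T where "T = max 1 (max \<sigma> (inverse \<sigma>))"
  have T: "T \<ge> 1" "\<sigma> \<le> T" "inverse \<sigma> \<le> T" by (auto simp: T_def)
  have le: "\<sigma> powr (- x) \<le> T powr (c + 2)" if "0 < x" "x \<le> c + 1" for x c
    using that T assms by (intro powr_le_powr_of_inverse_le) auto
  show thesis
  proof (rule that[of "3 * C" T])
    show "3 * C > 0" "T \<ge> 1" using C T by auto
    fix c assume c: "c0 \<le> c"
    have c': "c > 0" using assms c by simp
    let ?P = "T powr (c + 2)" and ?w = "\<lambda>x t. exp (- \<sigma> * t) * power_density x t"
    let ?B = "\<lambda>t. C * (1 + c) * (?w (c + 1) t + ?w (c - c0 / 2) t + ?w c t)"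
    note int = laplace_integrable_power_density[OF assms(2)]
    have ints: "set_integrable lborel {0<..} (?w (c + 1))" "set_integrable lborel {0<..} (?w (c - c0 / 2))"
      "set_integrable lborel {0<..} (?w c)"
      by (rule int; use c c' assms in simp)+
    have "(LINT t:{0<..}|lborel. exp (- \<sigma> * t) * \<bar>power_density_deriv c t\<bar>) \<le>
        (LINT t:{0<..}|lborel. ?B t)"
    proof (rule set_integral_mono)
      have "set_integrable lborel {0<..} (\<lambda>t. norm (exp (- of_real \<sigma> * of_real t) * complex_of_real (power_density_deriv c t)))"
        using assms c' by (intro set_integrable_norm laplace_power_density_deriv(1)) auto
      then show "set_integrable lborel {0<..} (\<lambda>t. exp (- \<sigma> * t) * \<bar>power_density_deriv c t\<bar>)"
        by (simp add: norm_mult)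
      show "set_integrable lborel {0<..} ?B"
        using ints by (intro set_integrable_mult_right set_integral_add) auto
      show "exp (- \<sigma> * t) * \<bar>power_density_deriv c t\<bar> \<le> ?B t" if "t \<in> {0<..}" for t
      proof -
        have "exp (- \<sigma> * t) * \<bar>power_density_deriv c t\<bar> \<le> exp (- \<sigma> * t) * (C * (1 + c) *
            (power_density (c + 1) t + power_density (c - c0 / 2) t + power_density c t))"
          using c that by (intro mult_left_mono C) auto
        then show ?thesis by (simp add: algebra_simps)
      qed
    qed
    also have "\<dots> = C * (1 + c) * ((LINT t:{0<..}|lborel. ?w (c + 1) t) +
        (LINT t:{0<..}|lborel. ?w (c - c0 / 2) t) + (LINT t:{0<..}|lborel. ?w c t))"
      using ints by (simp add: set_integral_add)
    also have "\<dots> = C * (1 + c) * (\<sigma> powr (- (c + 1)) + \<sigma> powr (- (c - c0 / 2)) + \<sigma> powr (- c))"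
      using laplace_power_density[OF assms(2), of "c + 1"] laplace_power_density[OF assms(2), of c]
        laplace_power_density[OF assms(2), of "c - c0 / 2"] c c' assms by simp
    also have "\<dots> \<le> C * (1 + c) * (?P + ?P + ?P)"
      using c c' assms C by (intro mult_left_mono add_mono le) auto
    finally show "(LINT t:{0<..}|lborel. exp (- \<sigma> * t) * \<bar>power_density_deriv c t\<bar>) \<le> 3 * C * (1 + c) * ?P"
      by (simp add: algebra_simps)
  qed
qed

section \<open>Termwise differentiation and integration of the Wright series\<close>

text \<open>
  Exponential growth in the order of the kernel is harmless because of the factorial, and the linear
  factors are absorbed by \<open>1 + k \<le> 2 ^ k\<close>.
\<close>

lemma summable_exponential_majorant:
  fixes \<alpha> \<beta> l x y C T :: real
  assumes "\<alpha> \<ge> 0" "\<beta> \<ge> 0" "C \<ge> 0" "T > 0"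
  shows "summable (\<lambda>k. \<bar>l\<bar> ^ k / fact k * \<bar>x * real k + y\<bar> *
      (C * (1 + (\<alpha> * real k + \<beta>)) * T powr (\<alpha> * real k + \<beta> + 2)))"
proof (rule summable_comparison_test')
  define D where "D = (\<bar>x\<bar> + \<bar>y\<bar>) * C * (1 + \<alpha> + \<beta>) * T powr (\<beta> + 2)"
  define z where "z = 4 * \<bar>l\<bar> * T powr \<alpha>"
  show "summable (\<lambda>k. D * (z ^ k / fact k))"
    using summable_exp_generic[of z] by (intro summable_mult) (simp add: field_simps)
  fix k :: nat assume "k \<ge> 0"
  have k2: "1 + real k \<le> 2 ^ k"
    by (induction k) auto
  have 1: "\<bar>x * real k + y\<bar> \<le> (\<bar>x\<bar> + \<bar>y\<bar>) * 2 ^ k"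
  proof -
    have "\<bar>x * real k + y\<bar> \<le> \<bar>x\<bar> * real k + \<bar>y\<bar>"
      using abs_triangle_ineq[of "x * real k" y] by (simp add: abs_mult)
    also have "\<dots> \<le> (\<bar>x\<bar> + \<bar>y\<bar>) * (1 + real k)"
      by (simp add: algebra_simps)
    also have "\<dots> \<le> (\<bar>x\<bar> + \<bar>y\<bar>) * 2 ^ k"
      using k2 by (intro mult_left_mono) auto
    finally show ?thesis .
  qed
  have 2: "1 + (\<alpha> * real k + \<beta>) \<le> (1 + \<alpha> + \<beta>) * 2 ^ k"
  proof -
    have "0 \<le> \<beta> * real k" using assms by simp
    then have "1 + (\<alpha> * real k + \<beta>) \<le> (1 + \<alpha> + \<beta>) * (1 + real k)"
      using assms by (simp add: algebra_simps)
    also have "\<dots> \<le> (1 + \<alpha> + \<beta>) * 2 ^ k"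
      using k2 assms by (intro mult_left_mono) auto
    finally show ?thesis .
  qed
  have T: "T powr (\<alpha> * real k + \<beta> + 2) = (T powr \<alpha>) ^ k * T powr (\<beta> + 2)"
  proof -
    have "(T powr \<alpha>) ^ k = T powr (\<alpha> * real k)"
      using assms by (simp add: powr_powr flip: powr_realpow)
    then show ?thesis by (simp only: add.assoc flip: powr_add)
  qed
  have "norm (\<bar>l\<bar> ^ k / fact k * \<bar>x * real k + y\<bar> *
      (C * (1 + (\<alpha> * real k + \<beta>)) * T powr (\<alpha> * real k + \<beta> + 2))) =
    \<bar>l\<bar> ^ k / fact k * \<bar>x * real k + y\<bar> *
      (C * (1 + (\<alpha> * real k + \<beta>)) * T powr (\<alpha> * real k + \<beta> + 2))"
    using assms by simp
  also have "\<dots> \<le> \<bar>l\<bar> ^ k / fact k * ((\<bar>x\<bar> + \<bar>y\<bar>) * 2 ^ k) *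
      (C * ((1 + \<alpha> + \<beta>) * 2 ^ k) * T powr (\<alpha> * real k + \<beta> + 2))"
    using assms 1 2 by (intro mult_mono mult_left_mono mult_right_mono) auto
  also have "\<dots> = D * ((2 * 2 * \<bar>l\<bar> * T powr \<alpha>) ^ k / fact k)"
    unfolding T D_def by (simp only: power_mult_distrib) (simp add: mult_ac)
  also have "\<dots> = D * (z ^ k / fact k)"
    by (simp add: z_def)
  finally show "norm (\<bar>l\<bar> ^ k / fact k * \<bar>x * real k + y\<bar> *
      (C * (1 + (\<alpha> * real k + \<beta>)) * T powr (\<alpha> * real k + \<beta> + 2))) \<le> D * (z ^ k / fact k)" .
qed

lemma Wright_power_density_series:
  assumes "a > 0" "b > 0" "t > 0"
  shows "summable (\<lambda>k. l ^ k / fact k * power_density (a * real k + b) t)"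
    and "t powr (b - 1) * Wright a b (l * t powr a) =
      (\<Sum>k. l ^ k / fact k * power_density (a * real k + b) t)"
proof -
  obtain C T where CT: "C > 0" "T \<ge> 1"
    "\<And>c. b \<le> c \<Longrightarrow> power_density c t \<le> C * (1 + c) * T powr (c + 2)"
    using power_density_deriv_pointwise_bound[OF assms(2,3)] by metis
  show summable: "summable (\<lambda>k. l ^ k / fact k * power_density (a * real k + b) t)"
  proof (rule summable_comparison_test')
    show "summable (\<lambda>k. \<bar>l\<bar> ^ k / fact k * \<bar>0 * real k + 1\<bar> *
        (C * (1 + (a * real k + b)) * T powr (a * real k + b + 2)))"
      using assms CT by (intro summable_exponential_majorant) auto
    fix k :: nat assume "k \<ge> 0"
    have "power_density (a * real k + b) t > 0"
      using assms by (intro power_density_pos add_nonneg_pos) auto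
    then have "norm (l ^ k / fact k * power_density (a * real k + b) t) =
        \<bar>l\<bar> ^ k / fact k * power_density (a * real k + b) t"
      by (simp add: abs_mult power_abs)
    also have "\<dots> \<le> \<bar>l\<bar> ^ k / fact k * (C * (1 + (a * real k + b)) * T powr (a * real k + b + 2))"
      using assms by (intro mult_left_mono CT) auto
    finally show "norm (l ^ k / fact k * power_density (a * real k + b) t) \<le>
        \<bar>l\<bar> ^ k / fact k * \<bar>0 * real k + 1\<bar> *
        (C * (1 + (a * real k + b)) * T powr (a * real k + b + 2))"
      by simp
  qed
  define w where "w = (\<lambda>k. (l * t powr a) ^ k / (fact k * Gamma (a * real k + b)))"
  have eq: "l ^ k / fact k * power_density (a * real k + b) t = t powr (b - 1) * w k" for k
  proof -
    have "t powr (a * real k + b - 1) = (t powr a) ^ k * t powr (b - 1)"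
      using assms by (simp add: add_diff_eq[symmetric] powr_add powr_powr flip: powr_realpow)
    then show ?thesis
      by (simp add: w_def power_density_def rGamma_inverse_Gamma power_mult_distrib field_simps)
  qed
  have "summable (\<lambda>k. t powr (b - 1) * w k)"
    using summable unfolding eq .
  then have "summable w"
    using assms by (subst (asm) summable_cmult_iff) simp
  then show "t powr (b - 1) * Wright a b (l * t powr a) =
      (\<Sum>k. l ^ k / fact k * power_density (a * real k + b) t)"
    unfolding eq Wright_def w_def by (rule suminf_mult[symmetric])
qed

text \<open>
  The two partial derivatives are the directions \<open>(1, 0)\<close> and \<open>(0, 1)\<close>. The order
  \<open>\<alpha> * k + \<beta>\<close> of the \<open>k\<close>-th kernel depends linearly on the parameters, so that a derivative in
  direction \<open>(x, y)\<close> contributes the factor \<open>x * k + y\<close>, and one proof serves both cases.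
\<close>

lemma Wright_directional_derivative:
  fixes \<alpha> \<beta> l t x y :: real
  assumes "\<alpha> > 0" "\<beta> > 0" "t > 0"
  shows "((\<lambda>u. t powr (\<beta> + u * y - 1) * Wright (\<alpha> + u * x) (\<beta> + u * y) (l * t powr (\<alpha> + u * x)))
      has_field_derivative
      (\<Sum>k. l ^ k / fact k * (x * real k + y) * power_density_deriv (\<alpha> * real k + \<beta>) t)) (at 0)"
proof -
  \<comment> \<open>for \<open>\<bar>u\<bar> < \<epsilon>\<close> both parameters change by at most half of their value, which keeps them
    positive and bounded\<close>
  define N where "N = 1 + \<bar>x\<bar> + \<bar>y\<bar>"
  define \<epsilon> where "\<epsilon> = min \<alpha> \<beta> / (2 * N)"
  have N: "N > 0" "\<bar>x\<bar> \<le> N" "\<bar>y\<bar> \<le> N" by (auto simp: N_def)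
  have eps: "\<epsilon> > 0" using assms N by (auto simp: \<epsilon>_def)
  let ?S = "{-\<epsilon><..<\<epsilon>}"
  define c where "c = (\<lambda>u k. (\<alpha> + u * x) * real k + (\<beta> + u * y))"
  have near: "\<alpha> / 2 \<le> \<alpha> + u * x" "\<alpha> + u * x \<le> 2 * \<alpha>" "\<beta> / 2 \<le> \<beta> + u * y" "\<beta> + u * y \<le> 2 * \<beta>"
    if "u \<in> ?S" for u
  proof -
    have *: "\<bar>u * v\<bar> \<le> min \<alpha> \<beta> / 2" if "\<bar>v\<bar> \<le> N" for v
    proof -
      have "\<bar>u * v\<bar> \<le> \<epsilon> * N"
        unfolding abs_mult using \<open>u \<in> ?S\<close> that eps by (intro mult_mono) auto
      also have "\<dots> = min \<alpha> \<beta> / 2" using N by (simp add: \<epsilon>_def)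
      finally show ?thesis .
    qed
    show "\<alpha> / 2 \<le> \<alpha> + u * x" "\<alpha> + u * x \<le> 2 * \<alpha>" "\<beta> / 2 \<le> \<beta> + u * y" "\<beta> + u * y \<le> 2 * \<beta>"
      using *[of x] *[of y] N assms by (auto simp: abs_le_iff)
  qed
  have c_bounds: "\<beta> / 2 \<le> c u k" "c u k \<le> 2 * \<alpha> * real k + 2 * \<beta>" if "u \<in> ?S" for u k
  proof -
    have "0 \<le> (\<alpha> + u * x) * real k" "(\<alpha> + u * x) * real k \<le> 2 * \<alpha> * real k"
      using near[OF that] assms by (auto intro!: mult_right_mono mult_nonneg_nonneg)
    then show "\<beta> / 2 \<le> c u k" "c u k \<le> 2 * \<alpha> * real k + 2 * \<beta>"
      using near(3,4)[OF that] unfolding c_def by linarith+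
  qed
  have "\<beta> / 2 > 0" using assms by simp
  obtain C T where CT: "C > 0" "T \<ge> 1"
    "\<And>c. \<beta> / 2 \<le> c \<Longrightarrow> \<bar>power_density_deriv c t\<bar> \<le> C * (1 + c) * T powr (c + 2)"
    using power_density_deriv_pointwise_bound[OF \<open>\<beta> / 2 > 0\<close> assms(3)] by metis
  let ?f = "\<lambda>k u. l ^ k / fact k * power_density (c u k) t"
  let ?f' = "\<lambda>k u. l ^ k / fact k * (x * real k + y) * power_density_deriv (c u k) t"
  have 1: "(?f k has_field_derivative ?f' k u) (at u within ?S)" if u: "u \<in> ?S" for k u
  proof -
    have "c u k > 0" using c_bounds(1)[OF u, of k] assms by simp
    then have "((\<lambda>u. power_density (c u k) t) has_field_derivative
        power_density_deriv (c u k) t * (x * real k + y)) (at u within ?S)"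
      using assms
      by (intro DERIV_chain2[OF has_field_derivative_power_density])
         (auto simp: c_def intro!: derivative_eq_intros)
    from DERIV_cmult[OF this, of "l ^ k / fact k"] show ?thesis
      by (simp add: mult_ac)
  qed
  have 2: "uniformly_convergent_on ?S (\<lambda>n u. \<Sum>k<n. ?f' k u)"
  proof (rule Weierstrass_m_test'_ev[OF always_eventually])
    show "summable (\<lambda>k. \<bar>l\<bar> ^ k / fact k * \<bar>x * real k + y\<bar> *
        (C * (1 + (2 * \<alpha> * real k + 2 * \<beta>)) * T powr (2 * \<alpha> * real k + 2 * \<beta> + 2)))"
      using assms CT by (intro summable_exponential_majorant) auto
    show "\<forall>k. \<forall>u\<in>?S. norm (?f' k u) \<le> \<bar>l\<bar> ^ k / fact k * \<bar>x * real k + y\<bar> *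
        (C * (1 + (2 * \<alpha> * real k + 2 * \<beta>)) * T powr (2 * \<alpha> * real k + 2 * \<beta> + 2))"
    proof (intro allI ballI)
      fix k u assume u: "u \<in> ?S"
      have "\<bar>power_density_deriv (c u k) t\<bar> \<le> C * (1 + c u k) * T powr (c u k + 2)"
        by (intro CT c_bounds u)
      also have "\<dots> \<le> C * (1 + (2 * \<alpha> * real k + 2 * \<beta>)) * T powr (2 * \<alpha> * real k + 2 * \<beta> + 2)"
        using c_bounds[OF u, of k] CT assms by (intro mult_mono powr_mono) auto
      finally have "\<bar>l\<bar> ^ k / fact k * \<bar>x * real k + y\<bar> * \<bar>power_density_deriv (c u k) t\<bar> \<le>
          \<bar>l\<bar> ^ k / fact k * \<bar>x * real k + y\<bar> *
          (C * (1 + (2 * \<alpha> * real k + 2 * \<beta>)) * T powr (2 * \<alpha> * real k + 2 * \<beta> + 2))"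
        by (intro mult_left_mono) auto
      then show "norm (?f' k u) \<le> \<bar>l\<bar> ^ k / fact k * \<bar>x * real k + y\<bar> *
          (C * (1 + (2 * \<alpha> * real k + 2 * \<beta>)) * T powr (2 * \<alpha> * real k + 2 * \<beta> + 2))"
        by (simp add: abs_mult power_abs)
    qed
  qed
  have series: "t powr (\<beta> + u * y - 1) * Wright (\<alpha> + u * x) (\<beta> + u * y) (l * t powr (\<alpha> + u * x)) =
      (\<Sum>k. ?f k u)" "summable (\<lambda>k. ?f k u)" if u: "u \<in> ?S" for u
    using near[OF u] assms Wright_power_density_series[of "\<alpha> + u * x" "\<beta> + u * y" t l]
    by (auto simp: c_def)
  have "((\<lambda>u. \<Sum>k. ?f k u) has_field_derivative (\<Sum>k. ?f' k 0)) (at 0)"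
    by (rule has_field_derivative_series'(2)[OF _ 1 2, of 0])
       (use series(2)[of 0] eps in \<open>auto simp: interior_open\<close>)
  then have "((\<lambda>u. t powr (\<beta> + u * y - 1) * Wright (\<alpha> + u * x) (\<beta> + u * y) (l * t powr (\<alpha> + u * x)))
      has_field_derivative (\<Sum>k. ?f' k 0)) (at 0)"
    by (rule has_field_derivative_transform_within_open[of _ _ _ ?S]) (use series(1) eps in auto)
  then show ?thesis by (simp add: c_def)
qed

lemma sums_linear_times_exp:
  fixes z p q :: complex
  shows "(\<lambda>k. z ^ k / fact k * (p * of_nat k + q)) sums ((p * z + q) * exp z)"
proof -
  have e: "(\<lambda>k. z ^ k / fact k) sums exp z"
    using exp_converges[of z] by (simp add: scaleR_conv_of_real field_simps)
  \<comment> \<open>the terms \<open>k * z ^ k / k!\<close> are, after an index shift, \<open>z\<close> times those of the exponential series\<close>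
  have "(\<lambda>k. z ^ Suc k / fact (Suc k) * of_nat (Suc k)) = (\<lambda>k. z * (z ^ k / fact k))"
  proof
    fix k :: nat
    have "z * w / (n * F) * n = z * (w / F)" if "n \<noteq> 0" for n w F :: complex
      using that by simp
    from this[OF of_nat_neq_0] show "z ^ Suc k / fact (Suc k) * of_nat (Suc k) = z * (z ^ k / fact k)"
      by (simp only: fact_Suc power_Suc of_nat_mult of_nat_fact)
  qed
  then have "(\<lambda>k. z ^ Suc k / fact (Suc k) * of_nat (Suc k)) sums (z * exp z)"
    using sums_mult[OF e, of z] by simp
  then have "(\<lambda>k. z ^ k / fact k * of_nat k) sums (z * exp z)"
    by (subst (asm) sums_Suc_iff) simp
  from sums_add[OF sums_mult[OF this, of p] sums_mult[OF e, of q]] show ?thesis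
    by (simp add: algebra_simps add_divide_distrib)
qed

text \<open>
  Since the \<open>L1\<close> norms of the terms are summable, the transform may be taken termwise. Each term
  contributes \<open>- Ln s * s powr (- (\<alpha> * k + \<beta>))\<close>, so that an exponential series in
  \<open>l * s powr (- \<alpha>)\<close> with linear coefficients remains to be summed.
\<close>

lemma laplace_Wright_derivative_series:
  fixes \<alpha> \<beta> l x y :: real and s :: complex
  assumes "\<alpha> > 0" "\<beta> > 0" "Re s > 0"
  defines "D \<equiv> (\<lambda>t. \<Sum>k. l ^ k / fact k * (x * real k + y) * power_density_deriv (\<alpha> * real k + \<beta>) t)"
  shows "laplace_convergent (\<lambda>t. complex_of_real (D t)) s"
    and "laplace (\<lambda>t. complex_of_real (D t)) s =
      - Ln s * (of_real x * (of_real l * s powr (- of_real \<alpha>)) + of_real y) * s powr (- of_real \<beta>) *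
        exp (of_real l * s powr (- of_real \<alpha>))"
proof -
  define c where "c = (\<lambda>k. \<alpha> * real k + \<beta>)"
  have c: "\<beta> \<le> c k" "c k > 0" for k
    using assms by (auto simp: c_def intro!: add_nonneg_pos)
  define m where "m = (\<lambda>k. l ^ k / fact k * (x * real k + y))"
  have abs_m: "\<bar>m k\<bar> = \<bar>l\<bar> ^ k / fact k * \<bar>x * real k + y\<bar>" for k
    by (simp add: m_def abs_mult power_abs)
  define h where "h = (\<lambda>k t. exp (- s * of_real t) * of_real (m k * power_density_deriv (c k) t))"
  define f where "f = (\<lambda>k t. indicator {0<..} t *\<^sub>R h k t)"
  have h_eq: "h k = (\<lambda>t. of_real (m k) * (exp (- s * of_real t) * of_real (power_density_deriv (c k) t)))" for k
    by (auto simp: h_def mult_ac)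
  have D_summable: "summable (\<lambda>k. \<bar>m k * power_density_deriv (c k) t\<bar>)" if t: "t > 0" for t
  proof -
    obtain C T where CT: "C > 0" "T \<ge> 1"
      "\<And>c. \<beta> \<le> c \<Longrightarrow> \<bar>power_density_deriv c t\<bar> \<le> C * (1 + c) * T powr (c + 2)"
      using power_density_deriv_pointwise_bound[OF assms(2) t] by metis
    show ?thesis
    proof (rule summable_comparison_test')
      show "summable (\<lambda>k. \<bar>l\<bar> ^ k / fact k * \<bar>x * real k + y\<bar> * (C * (1 + (\<alpha> * real k + \<beta>)) * T powr (\<alpha> * real k + \<beta> + 2)))"
        using assms CT by (intro summable_exponential_majorant) auto
      show "norm \<bar>m k * power_density_deriv (c k) t\<bar> \<le>
          \<bar>l\<bar> ^ k / fact k * \<bar>x * real k + y\<bar> * (C * (1 + (\<alpha> * real k + \<beta>)) * T powr (\<alpha> * real k + \<beta> + 2))" for k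
      proof -
        have "\<bar>m k\<bar> * \<bar>power_density_deriv (c k) t\<bar> \<le> \<bar>m k\<bar> * (C * (1 + c k) * T powr (c k + 2))"
          using c by (intro mult_left_mono CT) auto
        then show ?thesis by (simp add: abs_mult abs_m c_def)
      qed
    qed
  qed
  have f_int: "integrable lborel (f k)" for k
    using laplace_power_density_deriv(1)[OF assms(3) c(2)]
    unfolding f_def h_eq set_integrable_def[symmetric] by (rule set_integrable_mult_right)
  have f_val: "integral\<^sup>L lborel (f k) = of_real (m k) * (- Ln s * s powr (- of_real (c k)))" for k
    unfolding f_def h_eq set_lebesgue_integral_def[symmetric]
    by (subst set_integral_mult_right)
       (use laplace_power_density_deriv[OF assms(3) c(2)] in auto)
  have norm_f: "norm (f k t) = indicator {0<..} t * (exp (- Re s * t) * \<bar>m k * power_density_deriv (c k) t\<bar>)" for k t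
    by (simp add: f_def h_def norm_mult abs_mult)
  have f_ae: "AE t in lborel. summable (\<lambda>k. norm (f k t))"
  proof (intro AE_I2)
    show "summable (\<lambda>k. norm (f k t))" for t
    proof (cases "t > 0")
      case True
      then show ?thesis unfolding norm_f by (intro summable_mult D_summable)
    qed (simp add: f_def)
  qed
  have f_L1: "summable (\<lambda>k. LINT t|lborel. norm (f k t))"
  proof -
    obtain C T where CT: "C > 0" "T \<ge> 1"
      "\<And>c. \<beta> \<le> c \<Longrightarrow> (LINT t:{0<..}|lborel. exp (- Re s * t) * \<bar>power_density_deriv c t\<bar>)
          \<le> C * (1 + c) * T powr (c + 2)"
      using power_density_deriv_L1_bound[OF assms(2,3)] by metis
    show ?thesis
    proof (rule summable_comparison_test')
      show "summable (\<lambda>k. \<bar>l\<bar> ^ k / fact k * \<bar>x * real k + y\<bar> * (C * (1 + (\<alpha> * real k + \<beta>)) * T powr (\<alpha> * real k + \<beta> + 2)))"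
        using assms CT by (intro summable_exponential_majorant) auto
      fix k :: nat assume "k \<ge> 0"
      have "(LINT t|lborel. norm (f k t)) =
          \<bar>m k\<bar> * (LINT t:{0<..}|lborel. exp (- Re s * t) * \<bar>power_density_deriv (c k) t\<bar>)"
        unfolding norm_f set_lebesgue_integral_def abs_mult
        by (simp add: abs_mult mult_ac flip: integral_mult_right_zero)
      also have "\<dots> \<le> \<bar>m k\<bar> * (C * (1 + c k) * T powr (c k + 2))"
        using c by (intro mult_left_mono CT) auto
      finally show "norm (LINT t|lborel. norm (f k t)) \<le>
          \<bar>l\<bar> ^ k / fact k * \<bar>x * real k + y\<bar> * (C * (1 + (\<alpha> * real k + \<beta>)) * T powr (\<alpha> * real k + \<beta> + 2))"
        by (simp add: abs_m c_def)
    qed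
  qed
  have sum_f: "(\<Sum>k. f k t) = indicator {0<..} t *\<^sub>R (exp (- s * of_real t) * of_real (D t))" for t
  proof (cases "t > 0")
    case True
    have s: "summable (\<lambda>k. m k * power_density_deriv (c k) t)"
      using D_summable[OF True] by (rule summable_rabs_cancel)
    have "(\<Sum>k. f k t) = (\<Sum>k. exp (- s * of_real t) * complex_of_real (m k * power_density_deriv (c k) t))"
      using True by (simp add: f_def h_def)
    also have "\<dots> = exp (- s * of_real t) * (\<Sum>k. complex_of_real (m k * power_density_deriv (c k) t))"
      by (rule suminf_mult[OF summable_of_real[OF s]])
    also have "(\<Sum>k. complex_of_real (m k * power_density_deriv (c k) t)) = of_real (D t)"
      using suminf_of_real[OF s, where 'a = complex] by (simp only: D_def m_def c_def)
    finally show ?thesis using True by simp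
  qed (simp add: f_def)
  show "laplace_convergent (\<lambda>t. complex_of_real (D t)) s"
    using integrable_suminf[OF f_int f_ae f_L1]
    unfolding laplace_convergent_def set_integrable_def sum_f .
  have "(\<lambda>k. integral\<^sup>L lborel (f k)) sums laplace (\<lambda>t. complex_of_real (D t)) s"
    using sums_integral[OF f_int f_ae f_L1]
    unfolding laplace_def set_lebesgue_integral_def sum_f .
  moreover have "(\<lambda>k. integral\<^sup>L lborel (f k)) sums
      (- Ln s * s powr (- of_real \<beta>) * ((of_real x * (of_real l * s powr (- of_real \<alpha>)) + of_real y) *
        exp (of_real l * s powr (- of_real \<alpha>))))"
  proof -
    let ?z = "of_real l * s powr (- of_real \<alpha>)"
    have "integral\<^sup>L lborel (f k) =
        - Ln s * s powr (- of_real \<beta>) * (?z ^ k / fact k * (of_real x * of_nat k + of_real y))" for k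
    proof -
      have s0: "s \<noteq> 0" using assms by auto
      have "s powr (- of_real (c k)) = s powr (of_nat k * (- of_real \<alpha>) + (- of_real \<beta>))"
        by (simp add: c_def algebra_simps)
      also have "\<dots> = (s powr (- of_real \<alpha>)) ^ k * s powr (- of_real \<beta>)"
        using s0 by (subst powr_add) (simp add: powr_def exp_of_nat_mult[symmetric] algebra_simps)
      finally show ?thesis
        unfolding f_val by (simp add: m_def power_mult_distrib mult_ac)
    qed
    then show ?thesis
      using sums_mult[OF sums_linear_times_exp[of ?z "of_real x" "of_real y"],
          of "- Ln s * s powr (- of_real \<beta>)"] by simp
  qed
  ultimately have "laplace (\<lambda>t. complex_of_real (D t)) s =
      - Ln s * s powr (- of_real \<beta>) * ((of_real x * (of_real l * s powr (- of_real \<alpha>)) + of_real y) *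
        exp (of_real l * s powr (- of_real \<alpha>)))"
    by (rule sums_unique2)
  then show "laplace (\<lambda>t. complex_of_real (D t)) s =
      - Ln s * (of_real x * (of_real l * s powr (- of_real \<alpha>)) + of_real y) * s powr (- of_real \<beta>) *
        exp (of_real l * s powr (- of_real \<alpha>))"
    by (simp only: mult_ac)
qed

lemma laplace_cong:
  assumes "\<forall>t>0. f t = g t"
  shows "laplace_convergent f s = laplace_convergent g s" "laplace f s = laplace g s"
  unfolding laplace_convergent_def laplace_def
  by (intro set_integrable_cong set_lebesgue_integral_cong; use assms in simp)+

theorem corollary6:
  fixes \<alpha> \<beta> l :: real and s :: complex
  assumes "\<alpha> > 0" and "\<beta> > 0" and "Re s > 0"
  shows
    "((\<forall>t>0. (\<lambda>a. t powr (\<beta> - 1) * Wright a \<beta> (l * t powr a)) field_differentiable (at \<alpha>)) \<and>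
      laplace_convergent
        (\<lambda>t. complex_of_real (deriv (\<lambda>a. t powr (\<beta> - 1) * Wright a \<beta> (l * t powr a)) \<alpha>)) s \<and>
      laplace
        (\<lambda>t. complex_of_real (deriv (\<lambda>a. t powr (\<beta> - 1) * Wright a \<beta> (l * t powr a)) \<alpha>)) s
      = (- complex_of_real l * Ln s) / s powr complex_of_real (\<alpha> + \<beta>)
        * exp (complex_of_real l * s powr complex_of_real (- \<alpha>))) \<and>
     ((\<forall>t>0. (\<lambda>b. t powr (b - 1) * Wright \<alpha> b (l * t powr \<alpha>)) field_differentiable (at \<beta>)) \<and>
      laplace_convergent
        (\<lambda>t. complex_of_real (deriv (\<lambda>b. t powr (b - 1) * Wright \<alpha> b (l * t powr \<alpha>)) \<beta>)) s \<and>
      laplace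
        (\<lambda>t. complex_of_real (deriv (\<lambda>b. t powr (b - 1) * Wright \<alpha> b (l * t powr \<alpha>)) \<beta>)) s
      = (- Ln s) / s powr complex_of_real \<beta>
        * exp (complex_of_real l * s powr complex_of_real (- \<alpha>)))"
proof -
  define D where "D x y t =
    (\<Sum>k. l ^ k / fact k * (x * real k + y) * power_density_deriv (\<alpha> * real k + \<beta>) t)" for x y t
  let ?A = "\<lambda>t a. t powr (\<beta> - 1) * Wright a \<beta> (l * t powr a)"
  let ?B = "\<lambda>t b. t powr (b - 1) * Wright \<alpha> b (l * t powr \<alpha>)"
  note laplace_D = laplace_Wright_derivative_series[OF assms, of l, folded D_def]
  have A: "(?A t has_field_derivative D 1 0 t) (at \<alpha>)" if "t > 0" for t
    using Wright_directional_derivative[OF assms(1,2) that, where x = 1 and y = 0 and l = l, folded D_def]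
      DERIV_shift[of "?A t" "D 1 0 t" 0 \<alpha>] by (simp add: add.commute)
  have B: "(?B t has_field_derivative D 0 1 t) (at \<beta>)" if "t > 0" for t
    using Wright_directional_derivative[OF assms(1,2) that, where x = 0 and y = 1 and l = l, folded D_def]
      DERIV_shift[of "?B t" "D 0 1 t" 0 \<beta>] by (simp add: add.commute)
  have dA: "\<forall>t>0. complex_of_real (deriv (?A t) \<alpha>) = of_real (D 1 0 t)"
    using DERIV_imp_deriv[OF A] by simp
  have dB: "\<forall>t>0. complex_of_real (deriv (?B t) \<beta>) = of_real (D 0 1 t)"
    using DERIV_imp_deriv[OF B] by simp
  note laplace_A = laplace_cong[of "\<lambda>t. complex_of_real (deriv (?A t) \<alpha>)" "\<lambda>t. of_real (D 1 0 t)" s, OF dA]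
    and laplace_B = laplace_cong[of "\<lambda>t. complex_of_real (deriv (?B t) \<beta>)" "\<lambda>t. of_real (D 0 1 t)" s, OF dB]
  have s0: "s \<noteq> 0" using assms by auto
  have "\<forall>t>0. ?A t field_differentiable at \<alpha>" "\<forall>t>0. ?B t field_differentiable at \<beta>"
    using A B by (auto simp: field_differentiable_def)
  moreover have "laplace_convergent (\<lambda>t. complex_of_real (deriv (?A t) \<alpha>)) s"
    "laplace_convergent (\<lambda>t. complex_of_real (deriv (?B t) \<beta>)) s"
    unfolding laplace_A(1) laplace_B(1) by (rule laplace_D(1))+
  moreover have "laplace (\<lambda>t. complex_of_real (deriv (?A t) \<alpha>)) s =
      (- complex_of_real l * Ln s) / s powr complex_of_real (\<alpha> + \<beta>)
        * exp (complex_of_real l * s powr complex_of_real (- \<alpha>))"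
    unfolding laplace_A(2) laplace_D(2) using s0 by (simp add: powr_add powr_minus field_simps)
  moreover have "laplace (\<lambda>t. complex_of_real (deriv (?B t) \<beta>)) s =
      (- Ln s) / s powr complex_of_real \<beta>
        * exp (complex_of_real l * s powr complex_of_real (- \<alpha>))"
    unfolding laplace_B(2) laplace_D(2) using s0 by (simp add: powr_minus field_simps)
  ultimately show ?thesis by blast
qed

end
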